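(* Let $\mathbb{K}$ be a superalgebra of type $K_3(\alpha,\beta,\gamma)$ over a field $\mathbb{F}$. Then: (1) if $\mathbb{K}=K_3$, then $Der(\mathbb{K})_{\bar 0}\cong sl_2$, and the even derivations $d$ act by $$ed=0,\quad zd=\gamma_1z+\gamma_2w,\quad wd=\gamma_3z-\gamma_1w,\qquad \text{where } \gamma_1,\gamma_2,\gamma_3\in\mathbb{F};$$ $Der(\mathbb{K})_{\bar 1}$ is $2$-dimensional, and the odd derivations $d$ act by $$ed=\gamma_1z+\gamma_2w,\quad zd=-2\gamma_2e,\quad wd=2\gamma_1e,\qquad \text{where } \gamma_1,\gamma_2\in\mathbb{F};$$ (2) if $\mathbb{K}=K_3(\alpha)$, $\alpha\neq\frac12$, then $Der(\mathbb{K})$ is a one-dimensional Lie algebra, and the even derivations $d$ act by $$ed=0,\quad zd=\gamma z,\quad wd=-\gamma w,\qquad \text{where } \gamma\in\mathbb{F};$$ (3) if $\mathbb{K}=K_3^{1/2}$, then $Der(\mathbb{K})$ is a one-dimensional Lie algebra, and the even derivations $d$ act by $$ed=0,\quad zd=0,\quad wd=\gamma w,\qquad \text{where } \gamma\in\mathbb{F}.$$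
   Context: For $\alpha,\beta,\gamma\in\mathbb{F}$, $K_3(\alpha,\beta,\gamma)$ is the superalgebra with even part $\langle e\rangle$, odd part $\langle z,w\rangle$ (so $e,z,w$ is a basis) and multiplication $e^2=e$, $ez=\alpha z+\beta w$, $ew=\gamma z+(1-\alpha)w$, $ze=(1-\alpha)z-\beta w$, $we=\alpha w-\gamma z$, $z^2=-2\beta e$, $zw=2\alpha e$, $wz=-2(1-\alpha)e$, $w^2=2\gamma e$. Notation: $K_3(\alpha)=K_3(\alpha,0,0)$, $K_3=K_3(\frac12,0,0)$, $K_3^{1/2}=K_3(\frac12,\frac12,0)$. Linear maps are written on the right. A homogeneous (even or odd) linear map $d$ is a derivation if $(xy)d=(-1)^{p(d)p(y)}(xd)y+x(yd)$ for all homogeneous $x,y$, where $p$ denotes parity. $Der(\mathbb{K})=Der(\mathbb{K})_{\bar0}\oplus Der(\mathbb{K})_{\bar1}$ is the Lie superalgebra spanned by the even and odd derivations. In items (1)-(3) the symbols $\gamma,\gamma_1,\gamma_2,\gamma_3$ are free parameters describing the derivations.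
   Formalization: In (3) the even derivations act by ed=0, zd=γw, wd=0 (the printed zd=0, wd=γw fails on ez), and one-dimensionality of Der(K) is claimed only for characteristic not 3, where otherwise ed=w, zd=e, wd=0 is an odd derivation; characteristic not 2 is assumed since 1/2 occurs. *)

theory Defs
  imports "HOL-Analysis.Analysis" "HOL-Library.Z2" "HOL-Library.Function_Algebras"
begin

text \<open>Parities are elements of the two-element field \<^typ>\<open>bit\<close>, so that adding parities is
  addition modulo 2.\<close>

definition koszul_sign :: "bit \<Rightarrow> bit \<Rightarrow> 'f::field"
  where "koszul_sign p q = (if p * q = 1 then - 1 else 1)"

text \<open>Superalgebras are not assumed to be associative or unital.\<close>

locale superalgebra = vector_space scale
  for scale :: "'f::field \<Rightarrow> 'v::ab_group_add \<Rightarrow> 'v"  (infixr "*S" 75) +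
  fixes mult :: "'v \<Rightarrow> 'v \<Rightarrow> 'v"  (infixl "\<odot>" 70)
    and part :: "bit \<Rightarrow> 'v set"
  assumes linear_mult_left: "Vector_Spaces.linear (*S) (*S) (\<lambda>x. x \<odot> y)"
    and linear_mult_right: "Vector_Spaces.linear (*S) (*S) (\<lambda>y. x \<odot> y)"
    and subspace_part: "subspace (part p)"
    and part_Int: "part 0 \<inter> part 1 = {0}"
    and part_sum: "\<exists>a\<in>part 0. \<exists>b\<in>part 1. x = a + b"
    and mult_part: "x \<in> part p \<Longrightarrow> y \<in> part q \<Longrightarrow> x \<odot> y \<in> part (p + q)"
begin

definition endo_scale :: "'f \<Rightarrow> ('v \<Rightarrow> 'v) \<Rightarrow> ('v \<Rightarrow> 'v)"
  where "endo_scale c d = (\<lambda>x. c *S d x)"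

sublocale endo: vector_space endo_scale
  by unfold_locales (simp_all add: endo_scale_def fun_eq_iff algebra_simps)

text \<open>The derivations of parity \<open>p\<close>. Maps are thought of as written on the right: \<open>d x\<close> stands for
  \<open>xd\<close>, which is why the sign involves the parities of \<open>d\<close> and \<open>y\<close>.\<close>

definition Der_part :: "bit \<Rightarrow> ('v \<Rightarrow> 'v) set"
  where "Der_part p = {d. Vector_Spaces.linear (*S) (*S) d
    \<and> (\<forall>q. \<forall>x\<in>part q. d x \<in> part (q + p))
    \<and> (\<forall>r q. \<forall>x\<in>part r. \<forall>y\<in>part q.
          d (x \<odot> y) = koszul_sign p q *S (d x \<odot> y) + x \<odot> d y)}"

definition Der :: "('v \<Rightarrow> 'v) set"
  where "Der = endo.span (Der_part 0 \<union> Der_part 1)"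

text \<open>The supercommutator \<open>d d' - (-1)\<^sup>p\<^sup>q d' d\<close> of maps of parities \<open>p\<close> and \<open>q\<close>. As maps are
  written on the right, the product \<open>d d'\<close> is the composition \<open>d' \<circ> d\<close>.\<close>

definition supercommutator :: "bit \<Rightarrow> bit \<Rightarrow> ('v \<Rightarrow> 'v) \<Rightarrow> ('v \<Rightarrow> 'v) \<Rightarrow> ('v \<Rightarrow> 'v)"
  where "supercommutator p q d d' = (d' \<circ> d) - endo_scale (koszul_sign p q) (d \<circ> d')"

end

text \<open>A Lie algebra carried by the subset \<open>L\<close> of an ambient vector space.\<close>

locale lie_algebra = vector_space scale
  for scale :: "'f::field \<Rightarrow> 'v::ab_group_add \<Rightarrow> 'v" +
  fixes bracket :: "'v \<Rightarrow> 'v \<Rightarrow> 'v"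
    and L :: "'v set"
  assumes subspace_L: "subspace L"
    and bracket_closed: "x \<in> L \<Longrightarrow> y \<in> L \<Longrightarrow> bracket x y \<in> L"
    and bracket_add_left:
      "x \<in> L \<Longrightarrow> y \<in> L \<Longrightarrow> u \<in> L \<Longrightarrow> bracket (x + y) u = bracket x u + bracket y u"
    and bracket_add_right:
      "x \<in> L \<Longrightarrow> y \<in> L \<Longrightarrow> u \<in> L \<Longrightarrow> bracket u (x + y) = bracket u x + bracket u y"
    and bracket_scale_left:
      "x \<in> L \<Longrightarrow> y \<in> L \<Longrightarrow> bracket (scale c x) y = scale c (bracket x y)"
    and bracket_scale_right:
      "x \<in> L \<Longrightarrow> y \<in> L \<Longrightarrow> bracket x (scale c y) = scale c (bracket x y)"
    and bracket_self: "x \<in> L \<Longrightarrow> bracket x x = 0"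
    and jacobi: "x \<in> L \<Longrightarrow> y \<in> L \<Longrightarrow> u \<in> L \<Longrightarrow>
      bracket x (bracket y u) + bracket y (bracket u x) + bracket u (bracket x y) = 0"

definition lie_isomorphic ::
  "('f::field \<Rightarrow> 'v::ab_group_add \<Rightarrow> 'v) \<Rightarrow> ('v \<Rightarrow> 'v \<Rightarrow> 'v) \<Rightarrow> 'v set \<Rightarrow>
   ('f \<Rightarrow> 'u::ab_group_add \<Rightarrow> 'u) \<Rightarrow> ('u \<Rightarrow> 'u \<Rightarrow> 'u) \<Rightarrow> 'u set \<Rightarrow> bool"
  where "lie_isomorphic scale1 bracket1 L1 scale2 bracket2 L2 \<longleftrightarrow>
    lie_algebra scale1 bracket1 L1 \<and> lie_algebra scale2 bracket2 L2 \<and>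
    (\<exists>f. bij_betw f L1 L2
      \<and> (\<forall>x\<in>L1. \<forall>y\<in>L1. f (x + y) = f x + f y)
      \<and> (\<forall>c. \<forall>x\<in>L1. f (scale1 c x) = scale2 c (f x))
      \<and> (\<forall>x\<in>L1. \<forall>y\<in>L1. f (bracket1 x y) = bracket2 (f x) (f y)))"

definition matrix_scale :: "'f::field \<Rightarrow> 'f^'n^'m \<Rightarrow> 'f^'n^'m"
  where "matrix_scale c A = (\<chi> i. c *s A $ i)"

definition matrix_commutator :: "'f::field^'n^'n \<Rightarrow> 'f^'n^'n \<Rightarrow> 'f^'n^'n"
  where "matrix_commutator A B = A ** B - B ** A"

definition sl2 :: "('f::field^2^2) set"
  where "sl2 = {A. trace A = 0}"

definition K3_e :: "'f::field^3" where "K3_e = axis 1 1"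
definition K3_z :: "'f::field^3" where "K3_z = axis 2 1"
definition K3_w :: "'f::field^3" where "K3_w = axis 3 1"

definition K3_part :: "bit \<Rightarrow> ('f::field^3) set"
  where "K3_part p = (if p = 0 then vec.span {K3_e} else vec.span {K3_z, K3_w})"

text \<open>The bilinear extension of the multiplication table in the basis \<open>e\<close>, \<open>z\<close>, \<open>w\<close>; see the
  lemma \<open>K3_mult_table\<close>.\<close>

definition K3_mult :: "'f::field \<Rightarrow> 'f \<Rightarrow> 'f \<Rightarrow> 'f^3 \<Rightarrow> 'f^3 \<Rightarrow> 'f^3"
  where "K3_mult \<alpha> \<beta> \<gamma> x y =
      (x$1 * y$1) *s K3_e
    + (x$1 * y$2) *s (\<alpha> *s K3_z + \<beta> *s K3_w)
    + (x$1 * y$3) *s (\<gamma> *s K3_z + (1 - \<alpha>) *s K3_w)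
    + (x$2 * y$1) *s ((1 - \<alpha>) *s K3_z - \<beta> *s K3_w)
    + (x$3 * y$1) *s (\<alpha> *s K3_w - \<gamma> *s K3_z)
    + (x$2 * y$2) *s ((- 2 * \<beta>) *s K3_e)
    + (x$2 * y$3) *s ((2 * \<alpha>) *s K3_e)
    + (x$3 * y$2) *s ((- 2 * (1 - \<alpha>)) *s K3_e)
    + (x$3 * y$3) *s ((2 * \<gamma>) *s K3_e)"

lemma K3_mult_table:
  "K3_mult \<alpha> \<beta> \<gamma> K3_e K3_e = K3_e"
  "K3_mult \<alpha> \<beta> \<gamma> K3_e K3_z = \<alpha> *s K3_z + \<beta> *s K3_w"
  "K3_mult \<alpha> \<beta> \<gamma> K3_e K3_w = \<gamma> *s K3_z + (1 - \<alpha>) *s K3_w"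
  "K3_mult \<alpha> \<beta> \<gamma> K3_z K3_e = (1 - \<alpha>) *s K3_z - \<beta> *s K3_w"
  "K3_mult \<alpha> \<beta> \<gamma> K3_w K3_e = \<alpha> *s K3_w - \<gamma> *s K3_z"
  "K3_mult \<alpha> \<beta> \<gamma> K3_z K3_z = (- 2 * \<beta>) *s K3_e"
  "K3_mult \<alpha> \<beta> \<gamma> K3_z K3_w = (2 * \<alpha>) *s K3_e"
  "K3_mult \<alpha> \<beta> \<gamma> K3_w K3_z = (- 2 * (1 - \<alpha>)) *s K3_e"
  "K3_mult \<alpha> \<beta> \<gamma> K3_w K3_w = (2 * \<gamma>) *s K3_e"
  by (simp_all add: K3_mult_def K3_e_def K3_z_def K3_w_def axis_def vec_eq_iff)

lemma K3_part_iff: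
  "x \<in> K3_part p \<longleftrightarrow> (if p = 0 then x$2 = 0 \<and> x$3 = 0 else x$1 = 0)"
  by (auto simp: K3_part_def vec.span_insert vec.span_singleton vec_eq_iff forall_3
      K3_e_def K3_z_def K3_w_def axis_def algebra_simps)

lemma superalgebra_K3: "superalgebra (*s) (K3_mult \<alpha> \<beta> \<gamma>) K3_part"
proof unfold_locales
  show "\<exists>a\<in>K3_part 0. \<exists>b\<in>K3_part 1. x = a + b" for x :: "'a^3"
    by (rule bexI[of _ "x$1 *s K3_e"], rule bexI[of _ "x$2 *s K3_z + x$3 *s K3_w"])
      (simp_all add: K3_part_iff vec_eq_iff forall_3 K3_e_def K3_z_def K3_w_def axis_def)
  show "vec.subspace (K3_part p :: ('a^3) set)" for p
    by (simp add: K3_part_def vec.subspace_span)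
qed (auto simp: K3_part_iff vec_eq_iff forall_3 K3_mult_def K3_e_def K3_z_def K3_w_def axis_def
      algebra_simps split: if_splits)

global_interpretation K3: superalgebra "(*s)" "K3_mult \<alpha> \<beta> \<gamma>" K3_part
  for \<alpha> \<beta> \<gamma> :: "'f::field"
  by (rule superalgebra_K3)

end

theory Submission
  imports Defs
begin

text \<open>Leibniz' rule and homogeneity need only be tested on the basis \<open>e\<close>, \<open>z\<close>, \<open>w\<close>, where they become
  linear equations in the coordinates of \<open>ed\<close>, \<open>zd\<close>, \<open>wd\<close>. As maps are written on the right, the
  isomorphism of item (1) sends \<open>d\<close> to the matrix whose rows are the coordinates of \<open>zd\<close> and \<open>wd\<close>.\<close>

section \<open>Derivations of an arbitrary superalgebra\<close>

lemma koszul_sign_simps [simp]: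
  "koszul_sign 0 q = 1" "koszul_sign p 0 = 1" "koszul_sign 1 1 = - 1"
  by (simp_all add: koszul_sign_def)

context superalgebra
begin

lemma linear_iff:
  "Vector_Spaces.linear (*S) (*S) d \<longleftrightarrow>
    (\<forall>x y. d (x + y) = d x + d y) \<and> (\<forall>c x. d (c *S x) = c *S d x)"
  by (auto simp: Vector_Spaces.linear_iff vector_space_axioms)

lemma mult_simps:
  "(x + y) \<odot> u = x \<odot> u + y \<odot> u" "u \<odot> (x + y) = u \<odot> x + u \<odot> y"
  "(c *S x) \<odot> u = c *S (x \<odot> u)" "u \<odot> (c *S x) = c *S (u \<odot> x)"
  "0 \<odot> u = 0" "u \<odot> 0 = 0"
  "(x - y) \<odot> u = x \<odot> u - y \<odot> u" "u \<odot> (x - y) = u \<odot> x - u \<odot> y"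
proof -
  interpret l: Vector_Spaces.linear "(*S)" "(*S)" "\<lambda>x. x \<odot> u" for u
    by (rule linear_mult_left)
  interpret r: Vector_Spaces.linear "(*S)" "(*S)" "\<lambda>x. u \<odot> x" for u
    by (rule linear_mult_right)
  show "(x + y) \<odot> u = x \<odot> u + y \<odot> u" "u \<odot> (x + y) = u \<odot> x + u \<odot> y"
    "(c *S x) \<odot> u = c *S (x \<odot> u)" "u \<odot> (c *S x) = c *S (u \<odot> x)"
    "0 \<odot> u = 0" "u \<odot> 0 = 0"
    "(x - y) \<odot> u = x \<odot> u - y \<odot> u" "u \<odot> (x - y) = u \<odot> x - u \<odot> y"
    by (fact l.add r.add l.scale r.scale l.zero r.zero l.diff r.diff)+
qed

lemma Der_partD:
  assumes "d \<in> Der_part p"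
  shows "d (x + y) = d x + d y" "d (c *S x) = c *S d x"
    "d (x - y) = d x - d y"
proof -
  interpret Vector_Spaces.linear "(*S)" "(*S)" d
    using assms by (simp add: Der_part_def)
  show "d (x + y) = d x + d y" "d (c *S x) = c *S d x"
    "d (x - y) = d x - d y"
    by (fact add scale diff)+
qed

lemma subspace_Der_part: "endo.subspace (Der_part p)"
proof (rule endo.subspaceI)
  show "0 \<in> Der_part p"
    by (auto simp: Der_part_def linear_iff mult_simps subspace_0[OF subspace_part])
next
  fix d d' assume "d \<in> Der_part p" "d' \<in> Der_part p"
  then show "d + d' \<in> Der_part p"
    by (auto simp: Der_part_def linear_iff mult_simps algebra_simps subspace_add[OF subspace_part])
next
  fix c d assume "d \<in> Der_part p"
  then show "endo_scale c d \<in> Der_part p"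
    by (auto simp: Der_part_def linear_iff mult_simps algebra_simps endo_scale_def
        subspace_scale[OF subspace_part])
qed

lemma supercommutator_0_0: "supercommutator 0 0 d d' = (\<lambda>x. d' (d x) - d (d' x))"
  by (simp add: supercommutator_def endo_scale_def fun_eq_iff)

lemma Der_part_0_part:
  assumes "d \<in> Der_part 0" "x \<in> part q"
  shows "d x \<in> part q"
proof -
  have "d x \<in> part (q + 0)"
    using assms unfolding Der_part_def by blast
  then show ?thesis
    by (simp only: add_0_right)
qed

lemma Der_part_0_mult:
  assumes "d \<in> Der_part 0" "x \<in> part r" "y \<in> part q"
  shows "d (x \<odot> y) = d x \<odot> y + x \<odot> d y"
  using assms by (auto simp: Der_part_def)

text \<open>Applying Leibniz' rule twice to \<open>d' (d (x \<odot> y))\<close> produces the mixed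
  terms \<open>d x \<odot> d' y\<close> and \<open>d' x \<odot> d y\<close>. Their sum is symmetric
  in \<open>d\<close> and \<open>d'\<close>, so it cancels in the commutator.\<close>

lemma supercommutator_in_Der_part_0:
  assumes d: "d \<in> Der_part 0" "d' \<in> Der_part 0"
  shows "supercommutator 0 0 d d' \<in> Der_part 0"
proof -
  have "d' (d x) - d (d' x) \<in> part (q + 0)" if "x \<in> part q" for x q
    using d that by (simp only: add_0_right Der_part_0_part subspace_diff[OF subspace_part])
  moreover have "d' (d (x \<odot> y)) - d (d' (x \<odot> y)) =
      (d' (d x) - d (d' x)) \<odot> y + x \<odot> (d' (d y) - d (d' y))"
    if "x \<in> part r" "y \<in> part q" for x y r q
    using that by (simp add: d[THEN Der_part_0_mult, where r = r and q = q]
        d[THEN Der_part_0_part] d[THEN Der_partD(1)] mult_simps algebra_simps)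
  ultimately show ?thesis
    by (simp add: Der_part_def linear_iff supercommutator_0_0 d[THEN Der_partD(1)]
        d[THEN Der_partD(2)] algebra_simps)
qed

text \<open>Bilinearity, alternation and the Jacobi identity hold pointwise for commutators of
  linear maps; Leibniz' rule enters through closure under the bracket.\<close>

lemma lie_algebra_Der_part_0:
  "lie_algebra endo_scale (supercommutator 0 0) (Der_part 0)"
  by unfold_locales
    (simp_all add: subspace_Der_part supercommutator_in_Der_part_0,
     auto simp: supercommutator_0_0 fun_eq_iff endo_scale_def Der_partD algebra_simps)

text \<open>Serves items (2) and (3): without nonzero odd derivations \<open>Der\<close> is the span
  of a subspace, so the Lie algebra of even derivations is all of it.\<close>

lemma Der_eq_Der_part_0:
  assumes "Der_part 1 = {0}"
  shows "Der = Der_part 0"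
proof -
  have "Der_part 0 \<union> Der_part 1 = Der_part 0"
    using assms endo.subspace_0[OF subspace_Der_part] by auto
  then show ?thesis
    by (simp add: Der_def endo.span_eq_iff subspace_Der_part)
qed

end

section \<open>Coordinates and linear maps in the basis e, z, w\<close>

lemma linear_vec_iff:
  "Vector_Spaces.linear (*s) (*s) (d :: 'f::field^'n \<Rightarrow> 'f^'n) \<longleftrightarrow>
    (\<forall>x y. d (x + y) = d x + d y) \<and> (\<forall>c x. d (c *s x) = c *s d x)"
  by (auto simp: Vector_Spaces.linear_iff vec.vector_space_axioms)

lemma K3_basis_nth [simp]:
  "K3_e $ 1 = 1" "K3_e $ 2 = 0" "K3_e $ 3 = 0"
  "K3_z $ 1 = 0" "K3_z $ 2 = 1" "K3_z $ 3 = 0"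
  "K3_w $ 1 = 0" "K3_w $ 2 = 0" "K3_w $ 3 = 1"
  by (simp_all add: K3_e_def K3_z_def K3_w_def axis_def)

lemma vec3_eq_iff: "(x::'a^3) = y \<longleftrightarrow> x$1 = y$1 \<and> x$2 = y$2 \<and> x$3 = y$3"
  by (simp add: vec_eq_iff forall_3)

lemma K3_expand: "x = x$1 *s K3_e + x$2 *s K3_z + x$3 *s K3_w"
  by (simp add: vec3_eq_iff)

lemma K3_mult_nth:
  "K3_mult \<alpha> \<beta> \<gamma> x y $ 1 = x$1 * y$1 - 2 * \<beta> * (x$2 * y$2) + 2 * \<alpha> * (x$2 * y$3)
    - 2 * (1 - \<alpha>) * (x$3 * y$2) + 2 * \<gamma> * (x$3 * y$3)"
  "K3_mult \<alpha> \<beta> \<gamma> x y $ 2 = \<alpha> * (x$1 * y$2) + \<gamma> * (x$1 * y$3)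
    + (1 - \<alpha>) * (x$2 * y$1) - \<gamma> * (x$3 * y$1)"
  "K3_mult \<alpha> \<beta> \<gamma> x y $ 3 = \<beta> * (x$1 * y$2) + (1 - \<alpha>) * (x$1 * y$3)
    - \<beta> * (x$2 * y$1) + \<alpha> * (x$3 * y$1)"
  by (simp_all add: K3_mult_def algebra_simps)

text \<open>Normal form of a linear map: \<open>u\<close>, \<open>v\<close>, \<open>t\<close> are
  the images of e, z, w, that is, the rows of its matrix when maps are written on the right.\<close>

definition K3_linear :: "'f::field^3 \<Rightarrow> 'f^3 \<Rightarrow> 'f^3 \<Rightarrow> 'f^3 \<Rightarrow> 'f^3"
  where "K3_linear u v t x = x$1 *s u + x$2 *s v + x$3 *s t"

lemma linear_K3_linear: "Vector_Spaces.linear (*s) (*s) (K3_linear u v t)"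
  by (simp add: linear_vec_iff K3_linear_def algebra_simps)

lemma K3_linear_basis [simp]:
  "K3_linear u v t K3_e = u" "K3_linear u v t K3_z = v" "K3_linear u v t K3_w = t"
  by (simp_all add: K3_linear_def)

text \<open>A linear map is determined by its values on a basis. This passes between the normal form
  used for computing and the description by ed, zd, wd in the theorem.\<close>

lemma eq_K3_linear_iff:
  "d = K3_linear u v t \<longleftrightarrow>
    Vector_Spaces.linear (*s) (*s) d \<and> d K3_e = u \<and> d K3_z = v \<and> d K3_w = t"
proof
  assume *: "Vector_Spaces.linear (*s) (*s) d \<and> d K3_e = u \<and> d K3_z = v \<and> d K3_w = t"
  show "d = K3_linear u v t"
  proof
    fix x
    have "d x = d (x$1 *s K3_e + x$2 *s K3_z + x$3 *s K3_w)"
      using K3_expand[of x] by simp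
    also have "\<dots> = K3_linear u v t x"
      using * unfolding linear_vec_iff K3_linear_def by simp
    finally show "d x = K3_linear u v t x" .
  qed
qed (simp add: linear_K3_linear)

lemma endo_scale_K3_linear [simp]:
  "K3.endo_scale c (K3_linear u v t) = K3_linear (c *s u) (c *s v) (c *s t)"
  by (simp add: K3.endo_scale_def K3_linear_def fun_eq_iff algebra_simps)

lemma K3_linear_add:
  "K3_linear u v t + K3_linear u' v' t' = K3_linear (u + u') (v + v') (t + t')"
  by (simp add: K3_linear_def fun_eq_iff algebra_simps)

lemma K3_linear_0: "K3_linear 0 0 0 = 0"
  by (simp add: K3_linear_def fun_eq_iff)

lemma K3_linear_eq_iff [simp]:
  "K3_linear u v t = K3_linear u' v' t' \<longleftrightarrow> u = u' \<and> v = v' \<and> t = t'"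
  by (metis K3_linear_basis)

lemma K3_linear_eq_0_iff: "K3_linear u v t = 0 \<longleftrightarrow> u = 0 \<and> v = 0 \<and> t = 0"
  unfolding K3_linear_0[symmetric] by simp

section \<open>Testing derivations on homogeneous basis vectors\<close>

text \<open>Each vector is paired with its parity because the sign in Leibniz' rule depends on
  it.\<close>

definition K3_basis :: "(bit \<times> ('f::field^3)) set"
  where "K3_basis = {(0, K3_e), (1, K3_z), (1, K3_w)}"

lemma K3_basis_in_part: "(q, x) \<in> K3_basis \<Longrightarrow> x \<in> K3_part q"
  by (auto simp: K3_basis_def K3_part_iff)

lemma K3_part_induct [consumes 1, case_names basis add scale]:
  assumes "x \<in> K3_part q"
    and basis: "\<And>b. (q, b) \<in> K3_basis \<Longrightarrow> P b"
    and add: "\<And>x y. P x \<Longrightarrow> P y \<Longrightarrow> P (x + y)"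
    and scale: "\<And>c x. P x \<Longrightarrow> P (c *s x)"
  shows "P x"
proof (cases "q = 0")
  case True
  then have "x = x$1 *s K3_e"
    using assms(1) by (simp add: K3_part_iff vec3_eq_iff)
  then show ?thesis
    using scale basis True by (metis K3_basis_def insertI1)
next
  case False
  then have "x = x$2 *s K3_z + x$3 *s K3_w"
    using assms(1) by (simp add: K3_part_iff vec3_eq_iff)
  moreover have "P K3_z" "P K3_w"
    using False by (auto intro!: basis simp: K3_basis_def)
  ultimately show ?thesis
    using scale add by metis
qed

text \<open>For fixed parities the sign is constant, so both sides of Leibniz' rule are bilinear in
  \<open>x\<close> and \<open>y\<close>. Agreement on basis pairs extends to the homogeneous
  components by induction on \<open>x\<close> and, for basis vectors \<open>x\<close>, on
  \<open>y\<close>.\<close>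

lemma K3_Der_part_iff:
  "d \<in> K3.Der_part \<alpha> \<beta> \<gamma> p \<longleftrightarrow> Vector_Spaces.linear (*s) (*s) d \<and>
    (\<forall>(q, x)\<in>K3_basis. d x \<in> K3_part (q + p)) \<and>
    (\<forall>(r, x)\<in>K3_basis. \<forall>(q, y)\<in>K3_basis. d (K3_mult \<alpha> \<beta> \<gamma> x y) =
      koszul_sign p q *s K3_mult \<alpha> \<beta> \<gamma> (d x) y + K3_mult \<alpha> \<beta> \<gamma> x (d y))"
    (is "_ \<longleftrightarrow> ?lin \<and> ?par \<and> ?leib")
proof
  assume "d \<in> K3.Der_part \<alpha> \<beta> \<gamma> p"
  then show "?lin \<and> ?par \<and> ?leib"
    unfolding K3.Der_part_def by (blast dest: K3_basis_in_part)
next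
  assume *: "?lin \<and> ?par \<and> ?leib"
  then have add: "d (x + y) = d x + d y" and scale: "d (c *s x) = c *s d x" for x y c
    by (auto simp: linear_vec_iff)
  have "d x \<in> K3_part (q + p)" if "x \<in> K3_part q" for x q
    using that
    by (induction rule: K3_part_induct)
      (use * K3.subspace_part[of "q + p"] in \<open>auto simp only: add scale vec.subspace_def\<close>)
  moreover have "d (K3_mult \<alpha> \<beta> \<gamma> x y) =
      koszul_sign p q *s K3_mult \<alpha> \<beta> \<gamma> (d x) y + K3_mult \<alpha> \<beta> \<gamma> x (d y)"
    if "x \<in> K3_part r" "y \<in> K3_part q" for x y r q
    using that(1)
  proof (induction rule: K3_part_induct)
    case (basis b)
    from that(2) show ?case
      by (induction rule: K3_part_induct)
        (use * basis in \<open>auto simp: add scale K3.mult_simps algebra_simps\<close>)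
  qed (simp_all add: add scale K3.mult_simps algebra_simps)
  ultimately show "d \<in> K3.Der_part \<alpha> \<beta> \<gamma> p"
    using * by (simp add: K3.Der_part_def)
qed

lemma K3_linear_Der_part_iff:
  "K3_linear u v t \<in> K3.Der_part \<alpha> \<beta> \<gamma> p \<longleftrightarrow>
    (\<forall>(q, x)\<in>K3_basis. K3_linear u v t x \<in> K3_part (q + p)) \<and>
    (\<forall>(r, x)\<in>K3_basis. \<forall>(q, y)\<in>K3_basis. K3_linear u v t (K3_mult \<alpha> \<beta> \<gamma> x y) =
      koszul_sign p q *s K3_mult \<alpha> \<beta> \<gamma> (K3_linear u v t x) y
        + K3_mult \<alpha> \<beta> \<gamma> x (K3_linear u v t y))"
  by (simp add: K3_Der_part_iff linear_K3_linear)

lemma K3_Der_part_cases: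
  assumes "d \<in> K3.Der_part \<alpha> \<beta> \<gamma> p"
  obtains u v t where "d = K3_linear u v t"
  using assms by (auto simp: K3.Der_part_def eq_K3_linear_iff)

section \<open>Derivations as solutions of linear equations\<close>

lemmas K3_Der_part_simps = K3_basis_def K3_part_iff K3_linear_def K3_mult_nth vec3_eq_iff

text \<open>On the odd part, the products ez and ew say that the matrix of \<open>d\<close> commutes
  with that of left multiplication by e, whose rows are (\<alpha>, \<beta>) and (\<gamma>, 1 -
  \<alpha>); zw and wz together force trace zero. The last three equations are this commutation
  after substituting \<open>t$3 = - v$2\<close>.\<close>

lemma K3_linear_Der_part_0_iff:
  assumes "(2::'f::field) \<noteq> 0"
  shows "K3_linear u v t \<in> K3.Der_part (\<alpha>::'f) \<beta> \<gamma> 0 \<longleftrightarrow>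
    u = 0 \<and> v$1 = 0 \<and> t$1 = 0 \<and> t$3 = - v$2 \<and> \<beta> * t$2 = \<gamma> * v$3
    \<and> (2 * \<alpha> - 1) * v$3 = 2 * \<beta> * v$2 \<and> (2 * \<alpha> - 1) * t$2 = 2 * \<gamma> * v$2"
    (is "?D \<longleftrightarrow> ?R")
proof
  assume d: ?D
  have leib: "K3_linear u v t (K3_mult \<alpha> \<beta> \<gamma> x y) =
      K3_mult \<alpha> \<beta> \<gamma> (K3_linear u v t x) y + K3_mult \<alpha> \<beta> \<gamma> x (K3_linear u v t y)"
    if "(r, x) \<in> K3_basis" "(q, y) \<in> K3_basis" for r q x y
    using d that by (force simp: K3_linear_Der_part_iff)
  have 0: "u$2 = 0" "u$3 = 0" "v$1 = 0" "t$1 = 0"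
    using d by (simp_all add: K3_linear_Der_part_iff) (simp_all add: K3_Der_part_simps)
  \<comment> \<open>Leibniz' rule on ee = e reads \<open>u$1 = 2 * u$1\<close>.\<close>
  have "(2::'f) \<noteq> 1"
    by (metis add_cancel_left_right one_add_one zero_neq_one)
  then have "u$1 = 0"
    using leib[of 0 K3_e 0 K3_e] by (simp add: K3_Der_part_simps)
  moreover have ez: "\<beta> * t$2 = \<gamma> * v$3" "(2 * \<alpha> - 1) * v$3 = \<beta> * (v$2 - t$3)"
    using leib[of 0 K3_e 1 K3_z] by (simp_all add: K3_Der_part_simps 0 \<open>u$1 = 0\<close> algebra_simps)
  moreover have "(2 * \<alpha> - 1) * t$2 = \<gamma> * (v$2 - t$3)"
    using leib[of 0 K3_e 1 K3_w] by (simp add: K3_Der_part_simps 0 \<open>u$1 = 0\<close> algebra_simps)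
  moreover have "t$3 = - v$2"
  proof -
    \<comment> \<open>In the sum of the identities for zw and wz the terms with \<beta> and \<gamma>
      cancel, and the weights 2\<alpha> and 2(1 - \<alpha>) add up to 2.\<close>
    have "2 * \<alpha> * (v$2 + t$3) + 2 * \<gamma> * v$3 - 2 * \<beta> * t$2 = 0"
      using leib[of 1 K3_z 1 K3_w] by (simp add: K3_Der_part_simps 0 \<open>u$1 = 0\<close> algebra_simps)
    moreover have "2 * (1 - \<alpha>) * (v$2 + t$3) + 2 * \<beta> * t$2 - 2 * \<gamma> * v$3 = 0"
      using leib[of 1 K3_w 1 K3_z] by (simp add: K3_Der_part_simps 0 \<open>u$1 = 0\<close> algebra_simps)
    ultimately have "2 * (v$2 + t$3) = 0"
      by algebra
    then show ?thesis
      using assms by (metis add_eq_0_iff mult_eq_0_iff)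
  qed
  ultimately show ?R
    using 0 by (simp add: vec3_eq_iff)
next
  assume R: ?R
  then have "\<beta> * t$2 = \<gamma> * v$3" "(2 * \<alpha> - 1) * v$3 = 2 * \<beta> * v$2"
    "(2 * \<alpha> - 1) * t$2 = 2 * \<gamma> * v$2" "u = 0" "v$1 = 0" "t$1 = 0" "t$3 = - v$2"
    by simp_all
  note eqs = this
  show ?D
    unfolding K3_linear_Der_part_iff
    by (simp add: K3_Der_part_simps eqs(4-)) (intro conjI; use eqs(1-3) in algebra)
qed

text \<open>The products of e with z and w express zd and wd through ed; zw, zz and ww then
  constrain ed alone.\<close>

lemma K3_linear_Der_part_1_iff:
  assumes "(2::'f::field) \<noteq> 0"
  shows "K3_linear u v t \<in> K3.Der_part (\<alpha>::'f) \<beta> \<gamma> 1 \<longleftrightarrow>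
    u$1 = 0 \<and> v = (- 2 * u$3) *s K3_e \<and> t = (2 * u$2) *s K3_e
    \<and> (2 * \<alpha> - 1) * u$2 = \<gamma> * u$3 \<and> (2 * \<alpha> - 1) * u$3 = - (\<beta> * u$2)
    \<and> 3 * \<beta> * u$3 = 0 \<and> 3 * \<gamma> * u$2 = 0"
    (is "?D \<longleftrightarrow> ?R")
proof
  assume d: ?D
  have leib: "K3_linear u v t (K3_mult \<alpha> \<beta> \<gamma> x y) = koszul_sign 1 q *s
      K3_mult \<alpha> \<beta> \<gamma> (K3_linear u v t x) y + K3_mult \<alpha> \<beta> \<gamma> x (K3_linear u v t y)"
    if "(r, x) \<in> K3_basis" "(q, y) \<in> K3_basis" for r q x y
    using d that by (force simp: K3_linear_Der_part_iff)
  have 0: "u$1 = 0" "v$2 = 0" "v$3 = 0" "t$2 = 0" "t$3 = 0"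
    using d by (simp_all add: K3_linear_Der_part_iff) (simp_all add: K3_Der_part_simps)
  \<comment> \<open>Adding the identities for ez and ze removes the structure constants and leaves
    \<open>v$1 = 2 * u$3 + 2 * v$1\<close>; ew and we do the same for \<open>t$1\<close>.\<close>
  have "\<alpha> * v$1 + \<beta> * t$1 = 2 * (1 - \<alpha>) * u$3 + 2 * \<beta> * u$2 + v$1"
    using leib[of 0 K3_e 1 K3_z] by (simp add: K3_Der_part_simps 0 algebra_simps)
  moreover have "(1 - \<alpha>) * v$1 - \<beta> * t$1 = v$1 + 2 * \<alpha> * u$3 - 2 * \<beta> * u$2"
    using leib[of 1 K3_z 0 K3_e] by (simp add: K3_Der_part_simps 0 algebra_simps)
  ultimately have v: "v$1 = - 2 * u$3"
    by algebra
  have "\<gamma> * v$1 + (1 - \<alpha>) * t$1 = t$1 - 2 * \<alpha> * u$2 - 2 * \<gamma> * u$3"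
    using leib[of 0 K3_e 1 K3_w] by (simp add: K3_Der_part_simps 0 algebra_simps)
  moreover have "\<alpha> * t$1 - \<gamma> * v$1 = t$1 + 2 * \<gamma> * u$3 - 2 * (1 - \<alpha>) * u$2"
    using leib[of 1 K3_w 0 K3_e] by (simp add: K3_Der_part_simps 0 algebra_simps)
  ultimately have t: "t$1 = 2 * u$2"
    by algebra
  have "2 * \<alpha> * u$2 = (1 - \<alpha>) * t$1 - \<gamma> * v$1" "2 * \<alpha> * u$3 = - (1 - \<alpha>) * v$1 - \<beta> * t$1"
    using leib[of 1 K3_z 1 K3_w] by (simp_all add: K3_Der_part_simps 0 algebra_simps)
  \<comment> \<open>Substituting for \<open>v$1\<close> and \<open>t$1\<close> leaves a common
    factor 2, kept explicit so that \<open>2 \<noteq> 0\<close> can cancel it at the end.\<close>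
  then have "2 * ((2 * \<alpha> - 1) * u$2) = 2 * (\<gamma> * u$3)"
    "2 * ((2 * \<alpha> - 1) * u$3) = 2 * - (\<beta> * u$2)"
    unfolding v t by algebra+
  \<comment> \<open>As zz = -2\<beta>e, the w-coordinate of Leibniz' rule is
    \<open>- 2 * \<beta> * u$3 = 4 * \<beta> * u$3\<close>, whence the 3; ww behaves likewise in the
    z-coordinate.\<close>
  moreover have "2 * (3 * \<beta> * u$3) = 0"
    using leib[of 1 K3_z 1 K3_z] by (simp add: K3_Der_part_simps 0 v)
  moreover have "2 * (3 * \<gamma> * u$2) = 0"
    using leib[of 1 K3_w 1 K3_w] by (simp add: K3_Der_part_simps 0 t)
  ultimately show ?R
    using 0 v t assms unfolding mult_cancel_left mult_eq_0_iff[of 2] by (simp add: vec3_eq_iff)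
next
  assume R: ?R
  then have "(2 * \<alpha> - 1) * u$2 = \<gamma> * u$3" "(2 * \<alpha> - 1) * u$3 = - (\<beta> * u$2)"
    "3 * \<beta> * u$3 = 0" "3 * \<gamma> * u$2 = 0"
    "u$1 = 0" "v = (- 2 * u$3) *s K3_e" "t = (2 * u$2) *s K3_e"
    by simp_all
  note eqs = this
  show ?D
    unfolding K3_linear_Der_part_iff
    using [[simproc del: ring_eq_cancel_factor]]
      \<comment> \<open>otherwise the equations turn into disjunctions such as \<open>6 = 0 \<or> \<beta> = 0 \<or> u $ 3 = 0\<close>\<close>
    by (simp add: K3_Der_part_simps eqs(5-)
        del: mult_eq_0_iff mult_cancel_left mult_cancel_right vector_space_over_itself.scale_eq_0_iff)
      (intro conjI; (use eqs(1-4) in algebra | simp add: algebra_simps))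
qed

section \<open>Solving the equations for the three algebras\<close>

text \<open>Left multiplication by e is the scalar 1/2 on the odd part, so commuting with it is no
  restriction and only trace zero remains.\<close>

lemma K3_Der_part_0_half:
  assumes "(2::'f::field) \<noteq> 0"
  shows "d \<in> K3.Der_part (1/2::'f) 0 0 0 \<longleftrightarrow>
    (\<exists>a b c. d = K3_linear 0 (a *s K3_z + b *s K3_w) (c *s K3_z - a *s K3_w))"
proof
  assume d: "d \<in> K3.Der_part (1/2::'f) 0 0 0"
  then obtain u v t where uvt: "d = K3_linear u v t"
    by (rule K3_Der_part_cases)
  have "u = 0" "v = v$2 *s K3_z + v$3 *s K3_w" "t = t$2 *s K3_z - v$2 *s K3_w"
    using d assms by (simp_all add: uvt K3_linear_Der_part_0_iff vec3_eq_iff)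
  then show "\<exists>a b c. d = K3_linear 0 (a *s K3_z + b *s K3_w) (c *s K3_z - a *s K3_w)"
    unfolding uvt by metis
qed (use assms in \<open>auto simp: K3_linear_Der_part_0_iff\<close>)

text \<open>With \<open>2 * \<alpha> - 1\<close>, \<beta> and \<gamma> all zero, ed may be any odd
  vector, and it determines zd and wd.\<close>

lemma K3_Der_part_1_half:
  assumes "(2::'f::field) \<noteq> 0"
  shows "d \<in> K3.Der_part (1/2::'f) 0 0 1 \<longleftrightarrow>
    (\<exists>a b. d = K3_linear (a *s K3_z + b *s K3_w) ((- 2 * b) *s K3_e) ((2 * a) *s K3_e))"
proof
  assume d: "d \<in> K3.Der_part (1/2::'f) 0 0 1"
  then obtain u v t where uvt: "d = K3_linear u v t"
    by (rule K3_Der_part_cases)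
  have "u = u$2 *s K3_z + u$3 *s K3_w" "v = (- 2 * u$3) *s K3_e" "t = (2 * u$2) *s K3_e"
    using d assms by (simp_all add: uvt K3_linear_Der_part_1_iff vec3_eq_iff)
  then show "\<exists>a b. d = K3_linear (a *s K3_z + b *s K3_w) ((- 2 * b) *s K3_e) ((2 * a) *s K3_e)"
    unfolding uvt by metis
qed (use assms in \<open>auto simp: K3_linear_Der_part_1_iff\<close>)

text \<open>Left multiplication by e has the distinct eigenvalues \<alpha> and 1 - \<alpha> on z and
  w, so a matrix commuting with it is diagonal; trace zero leaves one parameter.\<close>

lemma K3_Der_part_0_not_half:
  assumes "(2::'f::field) \<noteq> 0" "\<alpha> \<noteq> (1/2::'f)"
  shows "d \<in> K3.Der_part \<alpha> 0 0 0 \<longleftrightarrow>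
    (\<exists>a. d = K3_linear 0 (a *s K3_z) (- (a *s K3_w)))"
proof
  assume d: "d \<in> K3.Der_part \<alpha> 0 0 0"
  then obtain u v t where uvt: "d = K3_linear u v t"
    by (rule K3_Der_part_cases)
  have "2 * \<alpha> - 1 \<noteq> 0"
    using assms by (auto simp: field_simps)
  then have "u = 0" "v = v$2 *s K3_z" "t = - (v$2 *s K3_w)"
    using d assms(1) by (simp_all add: uvt K3_linear_Der_part_0_iff vec3_eq_iff)
  then show "\<exists>a. d = K3_linear 0 (a *s K3_z) (- (a *s K3_w))"
    unfolding uvt by metis
qed (use assms(1) in \<open>auto simp: K3_linear_Der_part_0_iff\<close>)

text \<open>Since \<open>2 * \<alpha> - 1\<close> is invertible, ed vanishes, and with it zd and
  wd.\<close>

lemma K3_Der_part_1_not_half: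
  assumes "(2::'f::field) \<noteq> 0" "\<alpha> \<noteq> (1/2::'f)"
  shows "K3.Der_part \<alpha> 0 0 1 = {0}"
proof -
  have "2 * \<alpha> - 1 \<noteq> 0"
    using assms by (auto simp: field_simps)
  then have "d = 0" if d: "d \<in> K3.Der_part \<alpha> 0 0 1" for d
    using d assms(1) by (rule_tac K3_Der_part_cases[OF d])
      (simp add: K3_linear_Der_part_1_iff K3_linear_eq_0_iff vec3_eq_iff)
  then show ?thesis
    using K3.endo.subspace_0[OF K3.subspace_Der_part] by blast
qed

text \<open>On the odd part, left multiplication by e is 1/2 plus the nilpotent map sending z to w/2
  and w to 0. The matrices of trace zero commuting with it are the multiples of that nilpotent
  map.\<close>

lemma K3_Der_part_0_half_half:
  assumes "(2::'f::field) \<noteq> 0"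
  shows "d \<in> K3.Der_part (1/2::'f) (1/2) 0 0 \<longleftrightarrow> (\<exists>a. d = K3_linear 0 (a *s K3_w) 0)"
proof
  assume d: "d \<in> K3.Der_part (1/2::'f) (1/2) 0 0"
  then obtain u v t where uvt: "d = K3_linear u v t"
    by (rule K3_Der_part_cases)
  have "u = 0" "v = v$3 *s K3_w" "t = 0"
    using d assms by (simp_all add: uvt K3_linear_Der_part_0_iff vec3_eq_iff)
  then show "\<exists>a. d = K3_linear 0 (a *s K3_w) 0"
    unfolding uvt by metis
qed (use assms in \<open>auto simp: K3_linear_Der_part_0_iff\<close>)

text \<open>The equation \<open>(2 * \<alpha> - 1) * u$3 = - (\<beta> * u$2)\<close> gives
  \<open>u$2 = 0\<close>, while \<open>u$3 = 0\<close> comes from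
  \<open>3 * \<beta> * u$3 = 0\<close> and so rests on \<open>3 \<noteq> 0\<close>.\<close>

lemma K3_Der_part_1_half_half:
  assumes "(2::'f::field) \<noteq> 0" "(3::'f) \<noteq> 0"
  shows "K3.Der_part (1/2::'f) (1/2) 0 1 = {0}"
proof -
  have "d = 0" if d: "d \<in> K3.Der_part (1/2::'f) (1/2) 0 1" for d
    using d assms by (rule_tac K3_Der_part_cases[OF d])
      (simp add: K3_linear_Der_part_1_iff K3_linear_eq_0_iff vec3_eq_iff)
  then show ?thesis
    using K3.endo.subspace_0[OF K3.subspace_Der_part] by blast
qed

section \<open>The isomorphism with sl_2 and the dimensions\<close>

lemma (in vector_space) dim_singleton:
  assumes "b \<noteq> 0"
  shows "dim {b} = 1"
  using dim_eq_card_independent[of "{b}"] assms by (simp add: dependent_single)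

text \<open>With images as rows, first \<open>d\<close> and then \<open>d'\<close> corresponds to
  \<open>f d ** f d'\<close> in the same order, so brackets are preserved and not reversed.\<close>

lemma lie_isomorphic_Der_part_0_sl2:
  assumes "(2::'f::field) \<noteq> 0"
  shows "lie_isomorphic
        K3.endo_scale (K3.supercommutator 0 0) (K3.Der_part (1/2::'f) 0 0 0)
        matrix_scale matrix_commutator (sl2 :: ('f^2^2) set)"
proof -
  define f :: "('f^3 \<Rightarrow> 'f^3) \<Rightarrow> 'f^2^2"
    where "f d = vector [vector [d K3_z $ 2, d K3_z $ 3], vector [d K3_w $ 2, d K3_w $ 3]]" for d
  let ?D = "K3.Der_part (1/2::'f) 0 0 0"
  have mat2: "A = B \<longleftrightarrow> A$1$1 = B$1$1 \<and> A$1$2 = B$1$2 \<and> A$2$1 = B$2$1 \<and> A$2$2 = B$2$2"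
    for A B :: "'f^2^2"
    by (auto simp: vec_eq_iff forall_2)
  have f: "f d $ 1 $ 1 = d K3_z $ 2" "f d $ 1 $ 2 = d K3_z $ 3"
    "f d $ 2 $ 1 = d K3_w $ 2" "f d $ 2 $ 2 = d K3_w $ 3" for d
    by (simp_all add: f_def)
  note mat = mat2 matrix_scale_def matrix_commutator_def matrix_matrix_mult_def sum_2
    sl2_def trace_def
  interpret matrix: vector_space "matrix_scale :: 'f \<Rightarrow> 'f^2^2 \<Rightarrow> 'f^2^2"
    by unfold_locales (simp_all add: mat algebra_simps)
  have "lie_algebra matrix_scale matrix_commutator (sl2 :: ('f^2^2) set)"
  proof unfold_locales
    show "matrix.subspace sl2"
      by (auto simp: matrix.subspace_def mat algebra_simps add_eq_0_iff)
  qed (simp_all add: mat algebra_simps)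
  moreover have "bij_betw f ?D sl2"
  proof (rule bij_betwI)
    show "f \<in> ?D \<rightarrow> sl2"
      by (auto simp: K3_Der_part_0_half[OF assms] sl2_def trace_def sum_2 f)
    \<comment> \<open>The inverse map; the entry \<open>A$2$2\<close> is recovered as
      \<open>- A$1$1\<close> because the trace is zero.\<close>
    show "(\<lambda>A. K3_linear 0 (A$1$1 *s K3_z + A$1$2 *s K3_w) (A$2$1 *s K3_z - A$1$1 *s K3_w))
        \<in> sl2 \<rightarrow> ?D"
      unfolding K3_Der_part_0_half[OF assms] Pi_iff by blast
  qed (auto simp: K3_Der_part_0_half[OF assms] mat f vec3_eq_iff add_eq_0_iff)
  moreover have "f (K3.supercommutator 0 0 d d') = matrix_commutator (f d) (f d')"
    if "d \<in> ?D" "d' \<in> ?D" for d d'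
    using that by (auto simp: K3_Der_part_0_half[OF assms] K3.supercommutator_0_0 mat f
        K3_linear_def algebra_simps)
  ultimately show ?thesis
    unfolding lie_isomorphic_def
    by (auto intro!: K3.lie_algebra_Der_part_0 exI[of _ f] simp: mat f K3.endo_scale_def)
qed

lemma dim_K3_Der_part_1_half:
  assumes "(2::'f::field) \<noteq> 0"
  shows "K3.endo.dim (K3.Der_part (1/2::'f) 0 0 1) = 2"
proof -
  \<comment> \<open>The odd derivations with parameters (1, 0) and (0, 1). They are independent
    because they send e to z and to w.\<close>
  let ?d1 = "K3_linear K3_z 0 (2 *s K3_e) :: 'f^3 \<Rightarrow> 'f^3"
  let ?d2 = "K3_linear K3_w ((- 2) *s K3_e) 0 :: 'f^3 \<Rightarrow> 'f^3"
  have "K3.Der_part (1/2::'f) 0 0 1 = K3.endo.span {?d1, ?d2}"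
    by (simp add: set_eq_iff K3_Der_part_1_half[OF assms] K3.endo.span_insert
        K3.endo.span_singleton image_iff diff_eq_eq K3_linear_add ac_simps
        del: K3_linear_eq_iff)
  moreover have "?d1 \<notin> K3.endo.span {?d2}" "?d2 \<noteq> 0"
    by (auto simp: K3.endo.span_singleton vec3_eq_iff K3_linear_eq_0_iff)
  moreover have "?d1 \<noteq> ?d2"
    by (simp add: vec3_eq_iff)
  ultimately show ?thesis
    using K3.endo.dim_eq_card_independent[of "{?d1, ?d2}"]
    by (simp add: K3.endo.independent_insert del: K3_linear_eq_iff)
qed

lemma dim_K3_Der_not_half:
  assumes "(2::'f::field) \<noteq> 0" "\<alpha> \<noteq> (1/2::'f)"
  shows "K3.endo.dim (K3.Der \<alpha> 0 0) = 1"
proof -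
  \<comment> \<open>The even derivation with parameter 1; it spans \<open>Der\<close> because every
    odd derivation is zero.\<close>
  let ?d = "K3_linear 0 K3_z (- K3_w) :: 'f^3 \<Rightarrow> 'f^3"
  have "K3.Der \<alpha> 0 0 = K3.endo.span {?d}"
    by (simp add: set_eq_iff image_iff K3.Der_eq_Der_part_0[OF K3_Der_part_1_not_half[OF assms]]
        K3_Der_part_0_not_half[OF assms] K3.endo.span_singleton del: K3_linear_eq_iff)
  moreover have "?d \<noteq> 0"
    by (simp add: K3_linear_eq_0_iff vec3_eq_iff)
  ultimately show ?thesis
    using K3.endo.dim_singleton[of ?d] by simp
qed

lemma dim_K3_Der_half_half:
  assumes "(2::'f::field) \<noteq> 0" "(3::'f) \<noteq> 0"
  shows "K3.endo.dim (K3.Der (1/2::'f) (1/2) 0) = 1"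
proof -
  let ?d = "K3_linear 0 K3_w 0 :: 'f^3 \<Rightarrow> 'f^3"
  have "K3.Der (1/2::'f) (1/2) 0 = K3.endo.span {?d}"
    by (simp add: set_eq_iff image_iff K3.Der_eq_Der_part_0[OF K3_Der_part_1_half_half[OF assms]]
        K3_Der_part_0_half_half[OF assms(1)] K3.endo.span_singleton del: K3_linear_eq_iff)
  moreover have "?d \<noteq> 0"
    by (simp add: K3_linear_eq_0_iff vec3_eq_iff)
  ultimately show ?thesis
    using K3.endo.dim_singleton[of ?d] by simp
qed

text \<open>For the algebra of item (3) the equations give \<open>v$2 = 0\<close> and
  \<open>t$3 = - v$2\<close>, so an even derivation sends z to a multiple of w and kills w; the
  action zd = 0, wd = \<gamma>w obeys Leibniz' rule only for \<gamma> = 0. In characteristic 3 this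
  algebra has the nonzero odd derivation ed = w, zd = -2e, wd = 0, hence the condition
  \<open>3 \<noteq> 0\<close> on the claims about all of \<open>Der\<close>.\<close>

theorem theorem9:
  fixes \<alpha> :: "'f::field"
  assumes char_neq_2: "(2::'f) \<noteq> 0"
  shows
    "(lie_isomorphic
        K3.endo_scale (K3.supercommutator 0 0) (K3.Der_part (1/2::'f) 0 0 0)
        matrix_scale matrix_commutator (sl2 :: ('f^2^2) set)
      \<and> (\<forall>d. d \<in> K3.Der_part (1/2::'f) 0 0 0 \<longleftrightarrow>
          Vector_Spaces.linear (*s) (*s) d \<and>
          (\<exists>\<gamma>\<^sub>1 \<gamma>\<^sub>2 \<gamma>\<^sub>3. d K3_e = 0
            \<and> d K3_z = \<gamma>\<^sub>1 *s K3_z + \<gamma>\<^sub>2 *s K3_w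
            \<and> d K3_w = \<gamma>\<^sub>3 *s K3_z - \<gamma>\<^sub>1 *s K3_w))
      \<and> K3.endo.dim (K3.Der_part (1/2::'f) 0 0 1) = 2
      \<and> (\<forall>d. d \<in> K3.Der_part (1/2::'f) 0 0 1 \<longleftrightarrow>
          Vector_Spaces.linear (*s) (*s) d \<and>
          (\<exists>\<gamma>\<^sub>1 \<gamma>\<^sub>2. d K3_e = \<gamma>\<^sub>1 *s K3_z + \<gamma>\<^sub>2 *s K3_w
            \<and> d K3_z = (- 2 * \<gamma>\<^sub>2) *s K3_e
            \<and> d K3_w = (2 * \<gamma>\<^sub>1) *s K3_e)))
   \<and> (\<alpha> \<noteq> 1/2 \<longrightarrow>
        K3.Der_part \<alpha> 0 0 1 = {0}
      \<and> lie_algebra K3.endo_scale (K3.supercommutator 0 0) (K3.Der \<alpha> 0 0)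
      \<and> K3.endo.dim (K3.Der \<alpha> 0 0) = 1
      \<and> (\<forall>d. d \<in> K3.Der_part \<alpha> 0 0 0 \<longleftrightarrow>
          Vector_Spaces.linear (*s) (*s) d \<and>
          (\<exists>\<gamma>. d K3_e = 0 \<and> d K3_z = \<gamma> *s K3_z \<and> d K3_w = - (\<gamma> *s K3_w))))
   \<and> (((3::'f) \<noteq> 0 \<longrightarrow>
        K3.Der_part (1/2::'f) (1/2) 0 1 = {0}
      \<and> lie_algebra K3.endo_scale (K3.supercommutator 0 0) (K3.Der (1/2::'f) (1/2) 0)
      \<and> K3.endo.dim (K3.Der (1/2::'f) (1/2) 0) = 1)
      \<and> (\<forall>d. d \<in> K3.Der_part (1/2::'f) (1/2) 0 0 \<longleftrightarrow>
          Vector_Spaces.linear (*s) (*s) d \<and>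
          (\<exists>\<gamma>. d K3_e = 0 \<and> d K3_z = \<gamma> *s K3_w \<and> d K3_w = 0)))"
  using lie_isomorphic_Der_part_0_sl2[OF assms] dim_K3_Der_part_1_half[OF assms]
    K3_Der_part_1_not_half[OF assms] K3_Der_part_1_half_half[OF assms]
    dim_K3_Der_not_half[OF assms] dim_K3_Der_half_half[OF assms]
  by (auto simp: K3.Der_eq_Der_part_0 K3.lie_algebra_Der_part_0 eq_K3_linear_iff
      K3_Der_part_0_half[OF assms] K3_Der_part_1_half[OF assms]
      K3_Der_part_0_not_half[OF assms] K3_Der_part_0_half_half[OF assms])

end
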